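(* Let $R$ be a non-local finite commutative ring with unity. Then the upper ideal relation graph $\Gamma_U(R)$ is a split graph if and only if $R$ is isomorphic to $\mathbb{Z}_2 \times \mathbb{Z}_2 \times \mathbb{Z}_2$ or to $\mathbb{Z}_2 \times \mathbb{F}_q$ for some finite field $\mathbb{F}_q$.
   Context: Rings have a unity. A ring is local if it has a unique maximal ideal; a non-local finite commutative ring is (up to isomorphism) a direct product $R_1\times\cdots\times R_n$ of finite commutative local rings with $n\ge 2$. For $x\in R$, $(x)$ is the ideal generated by $x$. The upper ideal relation graph $\Gamma_U(R)$ is the simple undirected graph whose vertex set is the set of all non-unit elements of $R$ (including $0$), where two distinct vertices $x,y$ are adjacent if and only if there exists a non-unit $z\in R$ with $(x)\subseteq (z)$ and $(y)\subseteq (z)$. $\mathbb{F}_q$ denotes the field with $q$ elements. A graph is a split graph if its vertex set is the disjoint union of two sets $A$ and $B$, where $A$ induces a complete subgraph and $B$ is an independent set. *)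

theory Defs
  imports "HOL-Algebra.Algebra" "HOL-Number_Theory.Residues" "HOL-Library.Ramsey"
begin

definition local_ring :: "('a, 'm) ring_scheme \<Rightarrow> bool"
  where "local_ring R \<longleftrightarrow> (\<exists>!I. maximalideal I R)"

definition nonunits :: "('a, 'm) ring_scheme \<Rightarrow> 'a set"
  where "nonunits R = carrier R - Units R"

text \<open>The upper ideal relation graph has vertex set \<open>nonunits R\<close> and the following edge set.\<close>

definition upper_ideal_edges :: "('a, 'm) ring_scheme \<Rightarrow> 'a set set"
  where "upper_ideal_edges R =
    {{x, y} | x y. x \<in> nonunits R \<and> y \<in> nonunits R \<and> x \<noteq> y \<and>
       (\<exists>z \<in> nonunits R. Idl\<^bsub>R\<^esub> {x} \<subseteq> Idl\<^bsub>R\<^esub> {z} \<and> Idl\<^bsub>R\<^esub> {y} \<subseteq> Idl\<^bsub>R\<^esub> {z})}"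

text \<open>Simple graphs are given by a vertex set \<open>V\<close> and a set \<open>E\<close> of two-element subsets of \<open>V\<close>.
  Either part of the partition may be empty.\<close>

definition split_graph :: "'a set \<Rightarrow> 'a set set \<Rightarrow> bool"
  where "split_graph V E \<longleftrightarrow>
    (\<exists>A B. A \<union> B = V \<and> A \<inter> B = {} \<and> [A]\<^bsup>2\<^esup> \<subseteq> E \<and> [B]\<^bsup>2\<^esup> \<inter> E = {})"

end

theory Submission
  imports Defs
begin

text \<open>A finite ring whose only idempotents are \<open>0\<close> and \<open>1\<close> is local, since every element then is a
  unit or nilpotent; so \<open>R = eR \<times> fR\<close> for complementary idempotents \<open>e, f \<noteq> 0\<close>. If \<open>eR\<close> is not a
  field or \<open>fR\<close> has a unit other than \<open>f\<close>, there is an edge between two elements with a unit as second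
  component; if the same holds with \<open>e\<close> and \<open>f\<close> exchanged, there is also an edge between two elements
  with a unit as first component. No non-unit divides an endpoint of each, so the two edges form an
  induced \<open>2K\<^sub>2\<close>, which a split graph does not contain. Hence, in every such decomposition of \<open>R\<close>,
  one factor is a field and the other has only the trivial unit. If both are fields, the second is
  \<open>\<int>\<^sub>2\<close>. Otherwise the non-field factor decomposes further, and applying the dichotomy to the regrouped
  products shows that all three factors are \<open>\<int>\<^sub>2\<close>.\<close>

section \<open>Pairs of edges in a split graph\<close>

text \<open>Since \<open>B\<close> is independent, each edge has an endpoint in the clique
  \<open>A\<close>; the two endpoints found in this way are equal or adjacent.\<close>

lemma split_graph_no_2K2:
  assumes "split_graph V E" and "{p1, p2} \<in> E" "{q1, q2} \<in> E" and "p1 \<noteq> p2" "q1 \<noteq> q2"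
    and "{p1, p2, q1, q2} \<subseteq> V"
  shows "\<exists>p\<in>{p1, p2}. \<exists>q\<in>{q1, q2}. p = q \<or> {p, q} \<in> E"
proof -
  obtain A B where V: "A \<union> B = V" and A: "[A]\<^bsup>2\<^esup> \<subseteq> E" and B: "[B]\<^bsup>2\<^esup> \<inter> E = {}"
    using assms(1) by (auto simp: split_graph_def)
  have meet: "\<exists>x\<in>{x, y}. x \<in> A" if "{x, y} \<in> E" "x \<noteq> y" "x \<in> V" "y \<in> V" for x y
  proof (rule ccontr)
    assume "\<not> ?thesis"
    then have "{x, y} \<in> [B]\<^bsup>2\<^esup>"
      using that V by auto
    with B that(1) show False by blast
  qed
  obtain p where p: "p \<in> {p1, p2}" "p \<in> A"
    using meet[of p1 p2] assms by blast
  obtain q where q: "q \<in> {q1, q2}" "q \<in> A"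
    using meet[of q1 q2] assms by blast
  have "p = q \<or> {p, q} \<in> E"
    using p q A doubleton_in_nsets_2[of p q A] by blast
  with p q show ?thesis by blast
qed

section \<open>Complementary idempotents and their corner rings\<close>

context cring
begin

text \<open>This encodes a decomposition of \<open>R\<close> as eR x fR with both factors nonzero,
  without forming the factor rings: the components of \<open>x\<close> are
  \<open>x \<otimes> e\<close> and \<open>x \<otimes> f\<close>. Idempotence follows on multiplying
  the sum by \<open>e\<close> or \<open>f\<close>.\<close>

definition complementary :: "'a \<Rightarrow> 'a \<Rightarrow> bool" where
  "complementary e f \<longleftrightarrow> e \<in> carrier R \<and> f \<in> carrier R \<and> e \<oplus> f = \<one> \<and> e \<otimes> f = \<zero> \<and>
    e \<noteq> \<zero> \<and> f \<noteq> \<zero>"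

text \<open>For an idempotent \<open>e\<close>, the next three properties say that the ring \<open>eR\<close> with unity \<open>e\<close>
  is a field, has \<open>e\<close> as its only unit, and has at most the two elements \<open>0\<close> and \<open>e\<close>.\<close>

definition field_corner :: "'a \<Rightarrow> bool" where
  "field_corner e \<longleftrightarrow>
    (\<forall>x\<in>carrier R. x \<otimes> e = x \<longrightarrow> x \<noteq> \<zero> \<longrightarrow> (\<exists>y\<in>carrier R. x \<otimes> y = e))"

definition trivial_units_corner :: "'a \<Rightarrow> bool" where
  "trivial_units_corner e \<longleftrightarrow>
    (\<forall>x\<in>carrier R. \<forall>y\<in>carrier R. x \<otimes> e = x \<longrightarrow> x \<otimes> y = e \<longrightarrow> x = e)"

definition binary_corner :: "'a \<Rightarrow> bool" where
  "binary_corner e \<longleftrightarrow> (\<forall>x\<in>carrier R. x \<otimes> e = \<zero> \<or> x \<otimes> e = e)"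

lemma binary_corner_eqI:
  assumes "binary_corner e" "x \<in> carrier R" "y \<in> carrier R" "x \<otimes> e = \<zero> \<longleftrightarrow> y \<otimes> e = \<zero>"
  shows "x \<otimes> e = y \<otimes> e"
  using assms(1)[unfolded binary_corner_def, rule_format, OF assms(2)]
    assms(1)[unfolded binary_corner_def, rule_format, OF assms(3)] assms(4) by metis

lemma complementary_sym: "complementary e f \<Longrightarrow> complementary f e"
  by (auto simp: complementary_def a_comm m_comm)

lemma complementary_idem:
  assumes "complementary e f"
  shows "e \<otimes> e = e" and "f \<otimes> f = f" and "f \<otimes> e = \<zero>"
proof -
  have ef: "e \<in> carrier R" "f \<in> carrier R" "e \<oplus> f = \<one>" "e \<otimes> f = \<zero>"
    using assms by (auto simp: complementary_def)
  show fe: "f \<otimes> e = \<zero>" using ef m_comm[OF ef(2,1)] by simp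
  have "e \<otimes> e = e \<otimes> (e \<oplus> f)"
    using ef(1,2,4) by (simp add: r_distr)
  then show "e \<otimes> e = e" using ef by simp
  have "f \<otimes> f = f \<otimes> (e \<oplus> f)"
    using ef(1,2) fe by (simp add: r_distr)
  then show "f \<otimes> f = f" using ef by simp
qed

lemma complementary_split:
  assumes "complementary e f" "x \<in> carrier R"
  shows "x = x \<otimes> e \<oplus> x \<otimes> f"
proof -
  have "x \<otimes> e \<oplus> x \<otimes> f = x \<otimes> (e \<oplus> f)"
    using assms by (intro r_distr[symmetric]) (auto simp: complementary_def)
  also have "\<dots> = x"
    using assms by (simp add: complementary_def)
  finally show ?thesis by simp
qed

lemma annihilated_by_orthogonal:
  assumes "x \<in> carrier R" "e \<in> carrier R" "f \<in> carrier R" and "x \<otimes> f = x" "f \<otimes> e = \<zero>"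
  shows "x \<otimes> e = \<zero>"
  using m_assoc[of x f e] assms by simp

section \<open>Non-units, divisibility and edges\<close>

lemma nonunits_iff:
  "x \<in> nonunits R \<longleftrightarrow> x \<in> carrier R \<and> \<not> (\<exists>y\<in>carrier R. x \<otimes> y = \<one>)"
  by (auto simp: nonunits_def Units_def m_comm)

text \<open>A unit is not a zero divisor: if \<open>x \<otimes> y = \<one>\<close>, then
  \<open>a\<close> equals \<open>x \<otimes> a \<otimes> y\<close>, which is zero.\<close>

lemma nonunitsI:
  assumes "x \<in> carrier R" "a \<in> carrier R" "a \<noteq> \<zero>" "x \<otimes> a = \<zero>"
  shows "x \<in> nonunits R"
  unfolding nonunits_iff
proof (intro conjI notI assms)
  assume "\<exists>y\<in>carrier R. x \<otimes> y = \<one>"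
  then obtain y where y: "y \<in> carrier R" "x \<otimes> y = \<one>" by blast
  have "a = (x \<otimes> y) \<otimes> a" using y assms by simp
  also have "\<dots> = (x \<otimes> a) \<otimes> y" using y(1) assms(1,2) by algebra
  also have "\<dots> = \<zero>" using assms y by simp
  finally show False using assms(3) by simp
qed

text \<open>The cofactors of \<open>e\<close> and \<open>f\<close> add up to an inverse of
  \<open>z\<close>, because \<open>e \<oplus> f = \<one>\<close>. This is what keeps an edge over
  \<open>e\<close> apart from an edge over \<open>f\<close>.\<close>

lemma divides_unit_ideal:
  assumes "complementary e f" and "z \<in> carrier R" "z divides e" "z divides f"
  shows "z \<notin> nonunits R"
proof -
  have ef: "e \<oplus> f = \<one>" using assms by (simp add: complementary_def)
  obtain c d where c: "c \<in> carrier R" "e = z \<otimes> c" and d: "d \<in> carrier R" "f = z \<otimes> d"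
    using assms(3,4) by (auto simp: factor_def)
  have "z \<otimes> (c \<oplus> d) = e \<oplus> f"
    unfolding c(2) d(2) using c(1) d(1) assms(2) by (simp add: r_distr)
  with ef c d show ?thesis by (auto simp: nonunits_iff)
qed

text \<open>For principal ideals, to contain is to divide. From here on adjacency is handled through
  common non-unit divisors only.\<close>

lemma upper_ideal_edges_iff:
  "{x, y} \<in> upper_ideal_edges R \<longleftrightarrow> x \<in> nonunits R \<and> y \<in> nonunits R \<and> x \<noteq> y \<and>
    (\<exists>z\<in>nonunits R. z divides x \<and> z divides y)"
proof -
  have *: "Idl {x} \<subseteq> Idl {z} \<longleftrightarrow> z divides x" if "x \<in> nonunits R" "z \<in> nonunits R" for x z
    using that to_contain_is_to_divide[of z x]
    by (simp add: nonunits_iff cgenideal_eq_genideal)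
  have "{x, y} \<in> upper_ideal_edges R \<longleftrightarrow> x \<in> nonunits R \<and> y \<in> nonunits R \<and> x \<noteq> y \<and>
      (\<exists>z\<in>nonunits R. Idl {x} \<subseteq> Idl {z} \<and> Idl {y} \<subseteq> Idl {z})"
    by (auto simp: upper_ideal_edges_def doubleton_eq_iff)
  then show ?thesis
    using * by (metis (no_types, lifting))
qed

text \<open>With \<open>R = eR \<times> fR\<close>, the edge joins \<open>(0, 1)\<close> to \<open>(0, u)\<close> for a unit \<open>u \<noteq> 1\<close> of \<open>fR\<close>, or to \<open>(s, 1)\<close>
  for a non-unit \<open>s \<noteq> 0\<close> of \<open>eR\<close>.\<close>

lemma edge_over_corner:
  assumes ef: "complementary e f" and "\<not> (field_corner e \<and> trivial_units_corner f)"
  obtains p1 p2 where "p1 \<noteq> p2" "{p1, p2} \<in> upper_ideal_edges R" "p1 divides f" "p2 divides f"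
proof -
  have car: "e \<in> carrier R" "f \<in> carrier R" and nz: "e \<noteq> \<zero>" "f \<noteq> \<zero>"
    using ef by (auto simp: complementary_def)
  note id = complementary_idem[OF ef]
  have ef0: "e \<otimes> f = \<zero>" using ef by (auto simp: complementary_def)
  have f: "f \<in> nonunits R"
    using nonunitsI[OF car(2,1)] nz id by simp
  consider (u) u y where "u \<in> carrier R" "y \<in> carrier R" "u \<otimes> f = u" "u \<otimes> y = f" "u \<noteq> f"
    | (s) s where "s \<in> carrier R" "s \<otimes> e = s" "s \<noteq> \<zero>" "\<And>y. y \<in> carrier R \<Longrightarrow> s \<otimes> y \<noteq> e"
    using assms(2) unfolding field_corner_def trivial_units_corner_def by blast
  then show ?thesis
  proof cases
    case u
    have "u \<in> nonunits R"
      using nonunitsI[OF u(1) car(1)] annihilated_by_orthogonal[OF u(1) car] nz id u by simp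
    \<comment> \<open>\<open>u\<close> and \<open>f\<close> divide each other, so \<open>f\<close>
      itself serves as the common divisor.\<close>
    moreover have "f divides u" "f divides f" "u divides f"
      using u(1-4) car id m_comm[OF car(2) u(1)]
      by (auto intro: dividesI'[where c = u] dividesI'[where c = f] dividesI'[where c = y])
    ultimately have "{f, u} \<in> upper_ideal_edges R"
      using f u(5) unfolding upper_ideal_edges_iff by blast
    then show ?thesis
      using that \<open>f divides f\<close> \<open>u divides f\<close> u(5) by metis
  next
    case s
    have sf: "s \<otimes> f = \<zero>"
      using annihilated_by_orthogonal[OF s(1) car(2,1)] s ef0 by simp
    have t: "f \<oplus> s \<in> nonunits R"
    proof -
      have False if y: "y \<in> carrier R" "(f \<oplus> s) \<otimes> y = \<one>" for y
      proof -
        \<comment> \<open>Multiplication by \<open>e\<close> kills the summand \<open>f\<close>, so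
          an inverse of \<open>f \<oplus> s\<close> would yield an inverse of \<open>s\<close> in
          eR.\<close>
        have "s \<otimes> (y \<otimes> e) = ((f \<oplus> s) \<otimes> y) \<otimes> e \<ominus> (f \<otimes> e) \<otimes> y"
          using s(1) y(1) car by algebra
        also have "\<dots> = e"
          using y car id by (simp add: minus_eq)
        finally show False using s(4)[of "y \<otimes> e"] y car by simp
      qed
      then show ?thesis using s car by (auto simp: nonunits_iff)
    qed
    have m: "(f \<oplus> s) \<otimes> f = f"
      using s car sf id by (simp add: l_distr)
    have ne: "f \<oplus> s \<noteq> f"
    proof
      assume *: "f \<oplus> s = f"
      have "s = (f \<oplus> s) \<ominus> f" using s(1) car by algebra
      also have "\<dots> = \<zero>" using * car by algebra
      finally show False using s(3) by simp
    qed
    \<comment> \<open>Here the endpoint \<open>f \<oplus> s\<close> divides both endpoints and is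
      the common divisor.\<close>
    have d: "(f \<oplus> s) divides f" "f divides f" "(f \<oplus> s) divides (f \<oplus> s)"
      using m s(1) car by (auto intro: dividesI'[where c = f] dividesI'[where c = \<one>])
    have "{f \<oplus> s, f} \<in> upper_ideal_edges R"
      using t f ne d unfolding upper_ideal_edges_iff by blast
    then show ?thesis using that ne d by blast
  qed
qed

section \<open>Restrictions that a split graph puts on the corners\<close>

lemma split_imp_corner:
  assumes split: "split_graph (nonunits R) (upper_ideal_edges R)" and ef: "complementary e f"
  shows "field_corner e \<and> trivial_units_corner f \<or> field_corner f \<and> trivial_units_corner e"
proof (rule ccontr)
  assume neg: "\<not> ?thesis"
  obtain p1 p2 where p: "p1 \<noteq> p2" "{p1, p2} \<in> upper_ideal_edges R" "p1 divides f" "p2 divides f"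
    using edge_over_corner[OF ef] neg by metis
  obtain q1 q2 where q: "q1 \<noteq> q2" "{q1, q2} \<in> upper_ideal_edges R" "q1 divides e" "q2 divides e"
    using edge_over_corner[OF complementary_sym[OF ef]] neg by metis
  have "{p1, p2, q1, q2} \<subseteq> nonunits R"
    using p q by (auto simp: upper_ideal_edges_iff)
  then obtain x y where xy: "x \<in> {p1, p2}" "y \<in> {q1, q2}" "x = y \<or> {x, y} \<in> upper_ideal_edges R"
    and nu: "x \<in> nonunits R" "y \<in> nonunits R"
    using split_graph_no_2K2[OF split p(2) q(2) p(1) q(1)] by blast
  have xc: "x \<in> carrier R" using nu by (simp add: nonunits_iff)
  \<comment> \<open>If the two chosen endpoints coincide, that vertex is itself a common non-unit
    divisor, so both alternatives continue alike.\<close>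
  have "\<exists>z\<in>nonunits R. z divides x \<and> z divides y"
    using xy(3)
  proof
    assume "x = y"
    moreover have "x divides x" using xc by (auto simp: factor_def intro!: bexI[of _ \<one>])
    ultimately show ?thesis using nu by blast
  qed (simp add: upper_ideal_edges_iff)
  then obtain z where z: "z \<in> nonunits R" "z divides x" "z divides y" by blast
  have zc: "z \<in> carrier R" using z by (simp add: nonunits_iff)
  have "z divides f" "z divides e"
    using divides_trans[OF z(2)] divides_trans[OF z(3)] xy p q zc by blast+
  with divides_unit_ideal[OF ef zc] z show False by blast
qed

text \<open>A unit \<open>x\<close> of gR extends to the unit \<open>x \<oplus> e\<close> of the
  larger corner, with inverse \<open>e \<oplus> y \<otimes> g\<close>; triviality there forces
  \<open>x \<oplus> e = e \<oplus> g\<close>. The factor \<open>g\<close> projects the arbitrary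
  cofactor \<open>y\<close> into gR.\<close>

lemma trivial_units_corner_summand:
  assumes car: "e \<in> carrier R" "g \<in> carrier R" and id: "e \<otimes> e = e" "g \<otimes> g = g" "e \<otimes> g = \<zero>"
    and triv: "trivial_units_corner (e \<oplus> g)"
  shows "trivial_units_corner g"
  unfolding trivial_units_corner_def
proof (intro ballI impI)
  fix x y assume x: "x \<in> carrier R" "y \<in> carrier R" "x \<otimes> g = x" "x \<otimes> y = g"
  have ge: "g \<otimes> e = \<zero>" using m_comm[OF car] id by simp
  have xe: "x \<otimes> e = \<zero>"
    using annihilated_by_orthogonal[OF x(1) car] x ge by simp
  then have ex: "e \<otimes> x = \<zero>" using m_comm[OF x(1) car(1)] by simp
  have "(x \<oplus> e) \<otimes> (e \<oplus> g) = x \<otimes> e \<oplus> x \<otimes> g \<oplus> e \<otimes> e \<oplus> e \<otimes> g"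
    using x(1) car by algebra
  then have 1: "(x \<oplus> e) \<otimes> (e \<oplus> g) = x \<oplus> e"
    using x car xe id by simp
  have "(x \<oplus> e) \<otimes> (e \<oplus> y \<otimes> g) = x \<otimes> e \<oplus> (x \<otimes> y) \<otimes> g \<oplus> e \<otimes> e \<oplus> (e \<otimes> g) \<otimes> y"
    using x(1,2) car by algebra
  then have 2: "(x \<oplus> e) \<otimes> (e \<oplus> y \<otimes> g) = e \<oplus> g"
    using x(2,4) car xe id by (simp add: a_comm)
  have "x \<oplus> e = e \<oplus> g"
    using triv[unfolded trivial_units_corner_def, rule_format, OF _ _ 1 2] x(1,2) car by simp
  then have "(x \<oplus> e) \<ominus> e = (e \<oplus> g) \<ominus> e" by simp
  moreover have "(x \<oplus> e) \<ominus> e = x" "(e \<oplus> g) \<ominus> e = g" using x(1) car by algebra+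
  ultimately show "x = g" by simp
qed

text \<open>In a field whose only unit is the unity, every nonzero element is the unity; this is
  applied to the component \<open>x \<otimes> e\<close>.\<close>

lemma binary_cornerI:
  assumes "e \<in> carrier R" "e \<otimes> e = e" "field_corner e" "trivial_units_corner e"
  shows "binary_corner e"
  unfolding binary_corner_def
proof (intro ballI disjCI)
  fix x assume x: "x \<in> carrier R" "x \<otimes> e \<noteq> e"
  have "x \<otimes> e \<otimes> e = x \<otimes> e" using x assms by (simp add: m_assoc)
  then show "x \<otimes> e = \<zero>"
    using x assms(1,3,4) m_closed[OF x(1) assms(1)]
    unfolding field_corner_def trivial_units_corner_def by blast
qed


section \<open>Idempotents in finite rings\<close>

text \<open>By finiteness the powers of \<open>x\<close> repeat, so from some index \<open>i\<close>
  on they have a period \<open>p\<close>. A multiple \<open>n\<close> of \<open>p\<close> with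
  \<open>n \<ge> i\<close> then gives \<open>x [^] (n + n) = x [^] n\<close>.\<close>

lemma finite_idempotent_power:
  assumes "finite (carrier R)" and x: "x \<in> carrier R"
  obtains n :: nat where "n > 0" "x [^] n \<otimes> x [^] n = x [^] n"
proof -
  have "range (\<lambda>n::nat. x [^] n) \<subseteq> carrier R" using x by auto
  then have "\<not> inj (\<lambda>n::nat. x [^] n)"
    using finite_imageD[of "\<lambda>n::nat. x [^] n" UNIV] finite_subset[OF _ assms(1)] by auto
  then obtain i j :: nat where ij: "i < j" "x [^] i = x [^] j"
    unfolding inj_on_def by (metis UNIV_I linorder_neqE_nat)
  define p where "p = j - i"
  have p: "p > 0" "x [^] (i + p) = x [^] i" using ij by (auto simp: p_def)
  have step: "x [^] (n + p) = x [^] n" if "n \<ge> i" for n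
  proof -
    have "n + p = (i + p) + (n - i)" using that by simp
    then have "x [^] (n + p) = x [^] (i + p) \<otimes> x [^] (n - i)"
      using x by (simp only: nat_pow_mult)
    also have "\<dots> = x [^] n"
      unfolding p(2) using that x by (simp add: nat_pow_mult)
    finally show ?thesis .
  qed
  have period: "x [^] (n + m * p) = x [^] n" if "n \<ge> i" for n m
    by (induction m) (use that step in \<open>auto simp: add.assoc[symmetric] add.commute[of p]\<close>)
  \<comment> \<open>The factor \<open>Suc i\<close> instead of \<open>i\<close> keeps
    \<open>n\<close> positive when \<open>i = 0\<close>.\<close>
  define n where "n = Suc i * p"
  have "n \<ge> i" "n > 0" using p(1) by (auto simp: n_def intro: le_trans[of _ "i * p"])
  moreover have "x [^] n \<otimes> x [^] n = x [^] n"
    using period[OF \<open>n \<ge> i\<close>, of "Suc i"] x unfolding n_def[symmetric] by (simp add: nat_pow_mult)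
  ultimately show ?thesis using that by blast
qed

text \<open>As in the geometric series, \<open>\<one> \<ominus> x\<close> divides
  \<open>\<one> \<ominus> x [^] k\<close> for every \<open>k\<close>, and for \<open>k = n\<close>
  the latter is \<open>\<one>\<close>.\<close>

lemma one_minus_nilpotent:
  assumes x: "x \<in> carrier R" and "x [^] (n::nat) = \<zero>"
  shows "\<exists>y\<in>carrier R. (\<one> \<ominus> x) \<otimes> y = \<one>"
proof -
  have "\<exists>y\<in>carrier R. (\<one> \<ominus> x) \<otimes> y = \<one> \<ominus> x [^] k" for k :: nat
  proof (induction k)
    case 0
    show ?case using x by (intro bexI[of _ \<zero>]) (auto simp: minus_eq r_neg)
  next
    case (Suc k)
    then obtain y where y: "y \<in> carrier R" "(\<one> \<ominus> x) \<otimes> y = \<one> \<ominus> x [^] k" by blast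
    have a: "x [^] k \<in> carrier R" using x by simp
    have "(\<one> \<ominus> x) \<otimes> (y \<oplus> x [^] k) = (\<one> \<ominus> x) \<otimes> y \<oplus> (x [^] k \<ominus> x [^] k \<otimes> x)"
      using x y(1) a by algebra
    also have "\<dots> = \<one> \<ominus> x [^] k \<otimes> x"
      unfolding y(2) using x a by algebra
    finally show ?case using y(1) a by (intro bexI[of _ "y \<oplus> x [^] k"]) auto
  qed
  from this[of n] show ?thesis using assms(2) by (simp add: minus_eq)
qed

lemma nonunits_mult:
  assumes "x \<in> nonunits R" "u \<in> carrier R"
  shows "x \<otimes> u \<in> nonunits R"
  using assms m_assoc[of x u] unfolding nonunits_iff by (metis m_closed)

text \<open>Non-units absorb multiplication in any commutative ring, so closure under addition makes
  them an ideal. It contains every proper ideal and is therefore the only maximal one.\<close>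

lemma local_if_nonunits_ideal:
  assumes "\<one> \<noteq> \<zero>" and "\<And>x y. x \<in> nonunits R \<Longrightarrow> y \<in> nonunits R \<Longrightarrow> x \<oplus> y \<in> nonunits R"
  shows "local_ring R"
proof -
  have car: "nonunits R \<subseteq> carrier R" by (auto simp: nonunits_iff)
  have one: "\<one> \<notin> nonunits R" by (auto simp: nonunits_iff)
  have ideal: "ideal (nonunits R) R"
  proof (rule idealI[OF ring_axioms])
    show "subgroup (nonunits R) (add_monoid R)"
    proof (rule subgroup.intro)
      fix x assume x: "x \<in> nonunits R"
      have "\<ominus> x = x \<otimes> \<ominus> \<one>" using x car by (auto simp: r_minus)
      then show "inv\<^bsub>add_monoid R\<^esub> x \<in> nonunits R"
        using nonunits_mult[OF x, of "\<ominus> \<one>"] by (simp flip: a_inv_def)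
    next
      show "\<one>\<^bsub>add_monoid R\<^esub> \<in> nonunits R"
        using assms(1) by (auto simp: nonunits_iff)
    qed (use assms(2) car in auto)
    show "x \<otimes> a \<in> nonunits R" if "a \<in> nonunits R" "x \<in> carrier R" for a x
      using nonunits_mult[OF that] that car m_comm[of x a] by auto
    show "a \<otimes> x \<in> nonunits R" if "a \<in> nonunits R" "x \<in> carrier R" for a x
      using nonunits_mult[OF that] .
  qed
  have proper: "J \<subseteq> nonunits R" if J: "ideal J R" "J \<noteq> carrier R" for J
  proof
    interpret J: ideal J R by fact
    fix x assume x: "x \<in> J"
    have "\<one> \<notin> J" using J(2) J.one_imp_carrier by blast
    then show "x \<in> nonunits R"
      using J.I_r_closed[OF x] J.Icarr[OF x] by (force simp: nonunits_iff)
  qed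
  have max: "maximalideal (nonunits R) R"
  proof (rule maximalidealI[OF ideal])
    show "carrier R \<noteq> nonunits R" using one by blast
    show "J = nonunits R \<or> J = carrier R" if "ideal J R" "nonunits R \<subseteq> J" for J
      using proper that by blast
  qed
  show ?thesis
    unfolding local_ring_def
  proof (rule ex1I)
    show "maximalideal (nonunits R) R" by fact
    fix I assume "maximalideal I R"
    then interpret I: maximalideal I R .
    show "I = nonunits R"
      using proper[OF I.is_ideal] I.I_notcarr I.I_maximal[OF ideal _ car] one by blast
  qed
qed

text \<open>Non-locality yields two non-units with a unit as sum; scaling makes them
  \<open>z\<close> and \<open>\<one> \<ominus> z\<close>. The idempotent power of \<open>z\<close>
  is not zero, as otherwise \<open>z\<close> would be nilpotent and
  \<open>\<one> \<ominus> z\<close> a unit, and not one, as otherwise \<open>z\<close> would be a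
  unit.\<close>

lemma nonlocal_imp_complementary:
  assumes fin: "finite (carrier R)" and "\<one> \<noteq> \<zero>" and "\<not> local_ring R"
  obtains e f where "complementary e f"
proof -
  obtain x y where xy: "x \<in> nonunits R" "y \<in> nonunits R" "x \<oplus> y \<notin> nonunits R"
    using local_if_nonunits_ideal assms by blast
  have c: "x \<in> carrier R" "y \<in> carrier R" using xy by (auto simp: nonunits_iff)
  then obtain u where u: "u \<in> carrier R" "(x \<oplus> y) \<otimes> u = \<one>"
    using xy by (auto simp: nonunits_iff)
  define z where "z = y \<otimes> u"
  have z: "z \<in> nonunits R" "z \<in> carrier R" using nonunits_mult[OF xy(2) u(1)] c u by (auto simp: z_def)
  have xz: "\<one> \<ominus> z = x \<otimes> u"
  proof -
    have "\<one> \<ominus> z = (x \<oplus> y) \<otimes> u \<ominus> y \<otimes> u" using u by (simp add: z_def)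
    also have "\<dots> = x \<otimes> u" using c u(1) by algebra
    finally show ?thesis .
  qed
  obtain n :: nat where n: "n > 0" "z [^] n \<otimes> z [^] n = z [^] n"
    using finite_idempotent_power[OF fin z(2)] by blast
  define g where "g = z [^] n"
  have g: "g \<in> carrier R" "g \<otimes> g = g" using n z by (auto simp: g_def)
  have "g \<noteq> \<zero>"
  proof
    assume "g = \<zero>"
    then have "x \<otimes> u \<notin> nonunits R"
      using one_minus_nilpotent[OF z(2), of n] unfolding g_def xz by (auto simp: nonunits_iff)
    with nonunits_mult[OF xy(1) u(1)] show False by blast
  qed
  moreover have "g \<noteq> \<one>"
  proof
    assume "g = \<one>"
    then have "z \<otimes> z [^] (n - 1) = \<one>"
      using n(1) z(2) by (cases n) (auto simp: g_def m_comm)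
    with z show False by (auto simp: nonunits_iff)
  qed
  moreover have "g \<oplus> (\<one> \<ominus> g) = \<one>" using g(1) by algebra
  moreover have "g \<otimes> (\<one> \<ominus> g) = g \<ominus> g \<otimes> g" using g(1) by algebra
  then have "g \<otimes> (\<one> \<ominus> g) = \<zero>" using g by (simp add: r_right_minus_eq)
  ultimately show ?thesis
    using that[of g "\<one> \<ominus> g"] g(1) by (auto simp: complementary_def r_right_minus_eq)
qed

text \<open>The corner fR contains a nonzero non-unit \<open>s\<close>, and \<open>g\<close> is its
  idempotent power. If \<open>g\<close> were zero, \<open>f \<ominus> s\<close> would be a unit of
  fR other than \<open>f\<close>, against \<open>triv\<close>; if \<open>g\<close> were
  \<open>f\<close>, then \<open>s\<close> would be a unit of fR.\<close>

lemma refine_idempotent: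
  assumes fin: "finite (carrier R)" and f: "f \<in> carrier R" "f \<otimes> f = f"
    and triv: "trivial_units_corner f" and nf: "\<not> field_corner f"
  obtains g h where "g \<in> carrier R" "h \<in> carrier R" "g \<noteq> \<zero>" "h \<noteq> \<zero>" "g \<oplus> h = f" "g \<otimes> h = \<zero>"
    "g \<otimes> f = g" "h \<otimes> f = h"
proof -
  obtain s where s: "s \<in> carrier R" "s \<otimes> f = s" "s \<noteq> \<zero>" "\<And>y. y \<in> carrier R \<Longrightarrow> s \<otimes> y \<noteq> f"
    using nf unfolding field_corner_def by blast
  obtain n :: nat where n: "n > 0" "s [^] n \<otimes> s [^] n = s [^] n"
    using finite_idempotent_power[OF fin s(1)] by blast
  define g where "g = s [^] n"
  define h where "h = f \<ominus> g"
  have g: "g \<in> carrier R" "g \<otimes> g = g" using n s by (auto simp: g_def)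
  have h: "h \<in> carrier R" using f g by (simp add: h_def)
  obtain k where k: "n = Suc k" using n(1) by (cases n) auto
  have sk: "g = s \<otimes> s [^] k" using s(1) by (simp add: g_def k m_comm)
  have gf: "g \<otimes> f = g"
    using m_assoc[of "s [^] k" s f] s(1,2) f by (simp add: g_def k)
  then have fg: "f \<otimes> g = g" using m_comm[OF f(1) g(1)] by simp
  have "g \<noteq> \<zero>"
  proof
    assume "g = \<zero>"
    then obtain c where c: "c \<in> carrier R" "(\<one> \<ominus> s) \<otimes> c = \<one>"
      using one_minus_nilpotent[OF s(1), of n] by (auto simp: g_def)
    have 1: "(f \<ominus> s) \<otimes> f = f \<ominus> s"
    proof -
      have "(f \<ominus> s) \<otimes> f = f \<otimes> f \<ominus> s \<otimes> f" using f(1) s(1) by algebra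
      then show ?thesis using f s by simp
    qed
    \<comment> \<open>The inverse \<open>c\<close> of \<open>\<one> \<ominus> s\<close> in
      \<open>R\<close> projects to the inverse \<open>c \<otimes> f\<close> of
      \<open>f \<ominus> s\<close> in fR.\<close>
    have 2: "(f \<ominus> s) \<otimes> (c \<otimes> f) = f"
    proof -
      have "(f \<ominus> s) \<otimes> (c \<otimes> f) = (f \<otimes> f \<ominus> s \<otimes> f) \<otimes> c" using f(1) s(1) c(1) by algebra
      also have "\<dots> = (f \<ominus> s \<otimes> f) \<otimes> c" using f by simp
      also have "\<dots> = ((\<one> \<ominus> s) \<otimes> c) \<otimes> f" using f(1) s(1) c(1) by algebra
      finally show ?thesis using c f by simp
    qed
    have "f \<ominus> s = f"
      using triv[unfolded trivial_units_corner_def, rule_format, OF _ _ 1 2] s(1) c f by simp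
    then have "f \<ominus> (f \<ominus> s) = f \<ominus> f" by simp
    moreover have "f \<ominus> (f \<ominus> s) = s" "f \<ominus> f = \<zero>" using f(1) s(1) by algebra+
    ultimately show False using s(3) by simp
  qed
  moreover have "h \<noteq> \<zero>"
    using s(4)[of "s [^] k"] s(1) sk f g by (auto simp: h_def r_right_minus_eq)
  moreover have "g \<oplus> h = f" unfolding h_def using f(1) g(1) by algebra
  moreover have "g \<otimes> h = g \<otimes> f \<ominus> g \<otimes> g" unfolding h_def using f(1) g(1) by algebra
  then have "g \<otimes> h = \<zero>" using gf g by (simp add: r_right_minus_eq)
  moreover have "h \<otimes> f = f \<otimes> f \<ominus> g \<otimes> f" unfolding h_def using f(1) g(1) by algebra
  then have "h \<otimes> f = h" using f gf by (simp add: h_def)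
  ultimately show ?thesis using that g h gf by blast
qed

section \<open>Decompositions forced by a split graph\<close>

text \<open>The internal form of an isomorphism with Z_2 x Z_2 x Z_2: \<open>e\<close>,
  \<open>g\<close> and \<open>h\<close> play the roles of the three unit vectors.\<close>

definition binary_triple :: "'a \<Rightarrow> 'a \<Rightarrow> 'a \<Rightarrow> bool" where
  "binary_triple e g h \<longleftrightarrow> {e, g, h} \<subseteq> carrier R - {\<zero>} \<and> e \<oplus> g \<oplus> h = \<one> \<and>
    e \<otimes> g = \<zero> \<and> e \<otimes> h = \<zero> \<and> g \<otimes> h = \<zero> \<and>
    binary_corner e \<and> binary_corner g \<and> binary_corner h"

text \<open>Group \<open>R\<close> as (e+g)R x hR. The first factor is itself a product of two
  nonzero rings and so no field. Hence the dichotomy makes hR a field and the units of the first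
  factor trivial, which both summands inherit.\<close>

lemma split_imp_corner_of_triple:
  assumes split: "split_graph (nonunits R) (upper_ideal_edges R)"
    and car: "{e, g, h} \<subseteq> carrier R - {\<zero>}" and sum: "e \<oplus> g \<oplus> h = \<one>"
    and orth: "e \<otimes> g = \<zero>" "e \<otimes> h = \<zero>" "g \<otimes> h = \<zero>" and id: "e \<otimes> e = e" "g \<otimes> g = g"
  shows "field_corner h" and "trivial_units_corner e" and "trivial_units_corner g"
proof -
  have c: "e \<in> carrier R" "g \<in> carrier R" "h \<in> carrier R" and nz: "e \<noteq> \<zero>" "g \<noteq> \<zero>" "h \<noteq> \<zero>"
    using car by auto
  have ge: "g \<otimes> e = \<zero>" using m_comm[OF c(2,1)] orth by simp
  have eg: "(e \<oplus> g) \<otimes> g = g" "e \<otimes> (e \<oplus> g) = e"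
    using c orth id by (simp_all add: l_distr r_distr)
  have "complementary (e \<oplus> g) h"
    unfolding complementary_def using c nz sum orth eg by (auto simp: l_distr)
  moreover have "\<not> field_corner (e \<oplus> g)"
  proof
    \<comment> \<open>\<open>e\<close> is a nonzero element of this corner annihilated by
      \<open>g\<close>, so it cannot have an inverse there.\<close>
    assume "field_corner (e \<oplus> g)"
    then obtain y where y: "y \<in> carrier R" "e \<otimes> y = e \<oplus> g"
      using eg(2) c nz unfolding field_corner_def by blast
    have "g = (e \<otimes> y) \<otimes> g" using eg y by simp
    also have "\<dots> = (e \<otimes> g) \<otimes> y" using c(1,2) y(1) by algebra
    finally show False using orth y nz by simp
  qed
  ultimately have "field_corner h \<and> trivial_units_corner (e \<oplus> g)"
    using split_imp_corner[OF split] by blast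
  then show "field_corner h" "trivial_units_corner e" "trivial_units_corner g"
    using trivial_units_corner_summand[OF c(1,2) id orth(1)]
      trivial_units_corner_summand[OF c(2,1) id(2,1) ge] a_comm[OF c(1,2)] by auto
qed

lemma split_imp_decomposition:
  assumes fin: "finite (carrier R)" and "\<one> \<noteq> \<zero>" and "\<not> local_ring R"
    and split: "split_graph (nonunits R) (upper_ideal_edges R)"
  shows "(\<exists>e f. complementary e f \<and> binary_corner e \<and> field_corner f) \<or>
    (\<exists>e g h. binary_triple e g h)"
proof -
  obtain e' f' where "complementary e' f'"
    using nonlocal_imp_complementary assms by blast
  \<comment> \<open>The dichotomy is symmetric, so the names can be chosen such that eR is the
    field.\<close>
  then obtain e f where ef: "complementary e f" and fe: "field_corner e" "trivial_units_corner f"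
    using split_imp_corner[OF split] complementary_sym by blast
  have c: "e \<in> carrier R" "f \<in> carrier R" "e \<noteq> \<zero>" "e \<oplus> f = \<one>"
    using ef by (auto simp: complementary_def)
  note id = complementary_idem[OF ef]
  show ?thesis
  proof (cases "field_corner f")
    case True
    \<comment> \<open>Now fR is a field with trivial units, hence Z_2, and becomes the binary factor
      beside the field eR.\<close>
    then have "binary_corner f" using binary_cornerI id fe c by blast
    then show ?thesis using fe complementary_sym[OF ef] by blast
  next
    case False
    obtain g h where gh: "g \<in> carrier R" "h \<in> carrier R" "g \<noteq> \<zero>" "h \<noteq> \<zero>" "g \<oplus> h = f"
        "g \<otimes> h = \<zero>" "g \<otimes> f = g" "h \<otimes> f = h"
      using refine_idempotent[OF fin c(2) id(2) fe(2) False] by metis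
    have hg: "h \<otimes> g = \<zero>" using m_comm[OF gh(2,1)] gh by simp
    have eg: "e \<otimes> g = \<zero>" "e \<otimes> h = \<zero>"
      using annihilated_by_orthogonal[of g e f] annihilated_by_orthogonal[of h e f] gh c id
        m_comm[of e g] m_comm[of e h] by auto
    have "g = g \<otimes> (g \<oplus> h)" "h = h \<otimes> (g \<oplus> h)" using gh by auto
    then have gg: "g \<otimes> g = g" "h \<otimes> h = h"
      using gh(1,2,6) hg by (simp_all add: r_distr)
    have sum: "e \<oplus> g \<oplus> h = \<one>" "e \<oplus> h \<oplus> g = \<one>"
      using gh(1,2,5) c by (auto simp: a_assoc a_comm[of h g])
    have S: "{e, g, h} \<subseteq> carrier R - {\<zero>}" "{e, h, g} \<subseteq> carrier R - {\<zero>}" using c gh by auto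
    \<comment> \<open>The first grouping, (e+g)R x hR, makes hR a field and the units of eR and gR
      trivial; the second, (e+h)R x gR, exchanges \<open>g\<close> and \<open>h\<close>. Since eR is
      a field already, all three corners are fields with trivial units.\<close>
    note 1 = split_imp_corner_of_triple[OF split S(1) sum(1) eg gh(6) id(1) gg(1)]
    note 2 = split_imp_corner_of_triple[OF split S(2) sum(2) eg(2,1) hg id(1) gg(2)]
    have "binary_triple e g h"
      unfolding binary_triple_def
      using S(1) sum(1) eg gh(6) binary_cornerI[OF c(1) id(1) fe(1) 1(2)]
        binary_cornerI[OF gh(1) gg(1) 2(1) 1(3)] binary_cornerI[OF gh(2) gg(2) 1(1) 2(3)]
      by blast
    then show ?thesis by blast
  qed
qed


section \<open>Split partitions for the two kinds of product\<close>

text \<open>Rotation transfers facts proved for the first idempotent to the other two.\<close>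

lemma binary_triple_perm:
  assumes "binary_triple e g h"
  shows "binary_triple g h e"
proof -
  have c: "e \<in> carrier R" "g \<in> carrier R" "h \<in> carrier R"
    using assms by (auto simp: binary_triple_def)
  have "g \<oplus> h \<oplus> e = e \<oplus> g \<oplus> h" using c by algebra
  then show ?thesis
    using assms m_comm[OF c(1,2)] m_comm[OF c(1,3)] by (auto simp: binary_triple_def)
qed

lemma binary_triple_sum:
  assumes "binary_triple e g h" "x \<in> carrier R"
  shows "x = x \<otimes> e \<oplus> x \<otimes> g \<oplus> x \<otimes> h"
proof -
  have c: "e \<in> carrier R" "g \<in> carrier R" "h \<in> carrier R" "e \<oplus> g \<oplus> h = \<one>"
    using assms by (auto simp: binary_triple_def)
  have "x \<otimes> e \<oplus> x \<otimes> g \<oplus> x \<otimes> h = x \<otimes> (e \<oplus> g \<oplus> h)"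
    using c(1-3) assms(2) by algebra
  then show ?thesis using c(4) assms(2) by simp
qed

lemma binary_triple_idem:
  assumes "binary_triple e g h"
  shows "e \<otimes> e = e"
  using binary_triple_sum[OF assms, of e] assms by (auto simp: binary_triple_def)

text \<open>The clique is fR, the set of elements with first component zero, all divisible by the
  non-unit \<open>f\<close>. An element (1, b) with b nonzero is a unit, so \<open>e\<close> is the
  only other non-unit and forms the independent set alone.\<close>

lemma split_graph_of_binary_field:
  assumes ef: "complementary e f" and e: "binary_corner e" and f: "field_corner f"
  shows "split_graph (nonunits R) (upper_ideal_edges R)"
proof -
  have c: "e \<in> carrier R" "f \<in> carrier R" "e \<oplus> f = \<one>" "e \<otimes> f = \<zero>" "e \<noteq> \<zero>" "f \<noteq> \<zero>"
    using ef by (auto simp: complementary_def)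
  note id = complementary_idem[OF ef]
  define A where "A = {x \<in> carrier R. x \<otimes> e = \<zero>}"
  have eU: "e \<in> nonunits R" using nonunitsI[OF c(1,2)] c by simp
  have fU: "f \<in> nonunits R" using nonunitsI[OF c(2,1)] c id by simp
  have AU: "A \<subseteq> nonunits R" using nonunitsI[OF _ c(1,5)] by (auto simp: A_def)
  have "x = e" if x: "x \<in> nonunits R" "x \<notin> A" for x
  proof -
    have xc: "x \<in> carrier R" using x by (simp add: nonunits_iff)
    have xe: "x \<otimes> e = e"
      using x xc e unfolding A_def binary_corner_def by auto
    have "x \<otimes> f = \<zero>"
    proof (rule ccontr)
      assume "x \<otimes> f \<noteq> \<zero>"
      moreover have "x \<otimes> f \<otimes> f = x \<otimes> f" using xc c id by (simp add: m_assoc)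
      ultimately obtain y where y: "y \<in> carrier R" "x \<otimes> f \<otimes> y = f"
        using f xc c unfolding field_corner_def by (metis m_closed)
      \<comment> \<open>The inverse is assembled componentwise, with \<open>y\<close> inverting the
        second component.\<close>
      have "x \<otimes> (e \<oplus> f \<otimes> y) = x \<otimes> e \<oplus> x \<otimes> f \<otimes> y" using xc y(1) c(1,2) by algebra
      also have "\<dots> = \<one>" using xe y c by simp
      finally have "x \<otimes> (e \<oplus> f \<otimes> y) = \<one>" .
      with x y c show False by (auto simp: nonunits_iff)
    qed
    then show ?thesis using complementary_split[OF ef xc] xe c by simp
  qed
  then have "A \<union> {e} = nonunits R" using AU eU by blast
  moreover have "A \<inter> {e} = {}" using id c by (simp add: A_def)
  moreover have "[A]\<^bsup>2\<^esup> \<subseteq> upper_ideal_edges R"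
  proof
    fix d assume "d \<in> [A]\<^bsup>2\<^esup>"
    then obtain x y where d: "d = {x, y}" "x \<in> A" "y \<in> A" "x \<noteq> y" by (rule nsets2_E)
    have "f divides w" if "w \<in> A" for w
    proof (rule dividesI'[where c = w])
      show "w \<in> carrier R" using that by (simp add: A_def)
      then have "w = w \<otimes> f"
        using complementary_split[OF ef, of w] that c by (simp add: A_def)
      then show "w = f \<otimes> w" using m_comm[OF c(2) \<open>w \<in> carrier R\<close>] by simp
    qed
    then show "d \<in> upper_ideal_edges R"
      unfolding d(1) upper_ideal_edges_iff using d AU fU by blast
  qed
  moreover have "[{e}]\<^bsup>2\<^esup> \<inter> upper_ideal_edges R = {}" by (auto simp: nsets_2_eq)
  ultimately show ?thesis
    unfolding split_graph_def by (intro exI[of _ A] exI[of _ "{e}"] conjI)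
qed

text \<open>The common divisor is \<open>\<one> \<ominus> c\<close>: it is annihilated by
  \<open>c\<close>, hence a non-unit, and it acts as unity on everything annihilated by
  \<open>c\<close>.\<close>

lemma common_annihilator_edge:
  assumes x: "x \<in> carrier R" "y \<in> carrier R" "x \<noteq> y" and c: "c \<in> carrier R" "c \<noteq> \<zero>"
    and xc: "c \<otimes> c = c" "x \<otimes> c = \<zero>" "y \<otimes> c = \<zero>"
  shows "{x, y} \<in> upper_ideal_edges R"
proof -
  have "(\<one> \<ominus> c) \<otimes> c = c \<ominus> c \<otimes> c" using c(1) by algebra
  then have z: "\<one> \<ominus> c \<in> nonunits R"
    using nonunitsI[of "\<one> \<ominus> c" c] c xc by (simp add: r_right_minus_eq)
  have d: "(\<one> \<ominus> c) divides w" if w: "w \<in> carrier R" "w \<otimes> c = \<zero>" for w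
  proof (rule dividesI'[where c = w])
    have "(\<one> \<ominus> c) \<otimes> w = w \<ominus> w \<otimes> c" using c(1) w(1) by algebra
    then show "w = (\<one> \<ominus> c) \<otimes> w" using w by (simp add: minus_eq)
  qed fact
  then show ?thesis
    unfolding upper_ideal_edges_iff
    using x nonunitsI[OF x(1) c xc(2)] nonunitsI[OF x(2) c xc(3)] d[OF x(1) xc(2)] d[OF x(2) xc(3)]
    by (intro conjI bexI[OF _ z])
qed

text \<open>Each component has only two possible values, so knowing which components vanish
  determines the element.\<close>

lemma binary_triple_eqI:
  assumes t: "binary_triple e g h" and x: "x \<in> carrier R" "y \<in> carrier R"
    and "x \<otimes> e = \<zero> \<longleftrightarrow> y \<otimes> e = \<zero>" "x \<otimes> g = \<zero> \<longleftrightarrow> y \<otimes> g = \<zero>" "x \<otimes> h = \<zero> \<longleftrightarrow> y \<otimes> h = \<zero>"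
  shows "x = y"
proof -
  have "x \<otimes> e = y \<otimes> e" "x \<otimes> g = y \<otimes> g" "x \<otimes> h = y \<otimes> h"
    using assms binary_corner_eqI by (auto simp: binary_triple_def)
  then show ?thesis
    using binary_triple_sum[OF t x(1)] binary_triple_sum[OF t x(2)] by simp
qed

text \<open>Identifying \<open>R\<close> with the subsets of \<open>{e, g, h}\<close>, the clique consists of the subsets with
  at most one element and the independent set of those with exactly two.\<close>

lemma split_graph_of_binary_triple:
  assumes t: "binary_triple e g h"
  shows "split_graph (nonunits R) (upper_ideal_edges R)"
proof -
  have c: "e \<in> carrier R" "g \<in> carrier R" "h \<in> carrier R" "e \<noteq> \<zero>" "g \<noteq> \<zero>" "h \<noteq> \<zero>"
    using t by (auto simp: binary_triple_def)
  have id: "e \<otimes> e = e" "g \<otimes> g = g" "h \<otimes> h = h"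
    using t binary_triple_perm binary_triple_idem by blast+
  define A where "A = {x \<in> carrier R. x \<otimes> e = \<zero> \<and> x \<otimes> g = \<zero> \<or> x \<otimes> e = \<zero> \<and> x \<otimes> h = \<zero> \<or>
    x \<otimes> g = \<zero> \<and> x \<otimes> h = \<zero>}"
  have AU: "A \<subseteq> nonunits R"
    using nonunitsI[OF _ c(1,4)] nonunitsI[OF _ c(2,5)] by (auto simp: A_def)
  have clique: "[A]\<^bsup>2\<^esup> \<subseteq> upper_ideal_edges R"
  proof
    fix d assume "d \<in> [A]\<^bsup>2\<^esup>"
    then obtain x y where d: "d = {x, y}" "x \<in> A" "y \<in> A" "x \<noteq> y" by (rule nsets2_E)
    then have "x \<in> carrier R" "y \<in> carrier R"
      "x \<otimes> e = \<zero> \<and> y \<otimes> e = \<zero> \<or> x \<otimes> g = \<zero> \<and> y \<otimes> g = \<zero> \<or> x \<otimes> h = \<zero> \<and> y \<otimes> h = \<zero>"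
      by (auto simp: A_def)
    then show "d \<in> upper_ideal_edges R"
      unfolding d(1) using common_annihilator_edge d(4) c id by metis
  qed
  have indep: "{x, y} \<notin> upper_ideal_edges R" if x: "x \<in> nonunits R - A" "y \<in> nonunits R - A" for x y
  proof
    assume "{x, y} \<in> upper_ideal_edges R"
    then obtain z where ne: "x \<noteq> y" and z: "z \<in> nonunits R" "z divides x" "z divides y"
      by (auto simp: upper_ideal_edges_iff)
    have car: "x \<in> carrier R" "y \<in> carrier R" "z \<in> carrier R"
      using x z by (auto simp: nonunits_iff)
    have "z \<noteq> \<one>" using z by (auto simp: nonunits_iff)
    \<comment> \<open>All three components of \<open>\<one>\<close> are nonzero, so
      \<open>z\<close>, being different, has a vanishing component, which its multiples
      \<open>x\<close> and \<open>y\<close> inherit.\<close>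
    then have "z \<otimes> e = \<zero> \<or> z \<otimes> g = \<zero> \<or> z \<otimes> h = \<zero>"
      using binary_triple_eqI[OF t car(3) one_closed] c by auto
    moreover have "w \<otimes> k = \<zero>" if "z divides w" "z \<otimes> k = \<zero>" "k \<in> carrier R" for w k
    proof -
      obtain r where r: "r \<in> carrier R" "w = z \<otimes> r" using \<open>z divides w\<close> by (auto simp: factor_def)
      have "w \<otimes> k = (z \<otimes> k) \<otimes> r" unfolding r(2) using r(1) car(3) that(3) by algebra
      then show ?thesis using that r by simp
    qed
    ultimately have "x \<otimes> e = \<zero> \<and> y \<otimes> e = \<zero> \<or> x \<otimes> g = \<zero> \<and> y \<otimes> g = \<zero> \<or> x \<otimes> h = \<zero> \<and> y \<otimes> h = \<zero>"
      using z(2,3) c(1-3) by blast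
    \<comment> \<open>Outside \<open>A\<close> at most one component vanishes, so the one shared by
      \<open>x\<close> and \<open>y\<close> is the only one for both.\<close>
    then have "x = y"
      using x car by (intro binary_triple_eqI[OF t]) (auto simp: A_def)
    with ne show False by blast
  qed
  have "[nonunits R - A]\<^bsup>2\<^esup> \<inter> upper_ideal_edges R = {}"
  proof (rule ccontr)
    assume "\<not> ?thesis"
    then obtain d where d: "d \<in> [nonunits R - A]\<^bsup>2\<^esup>" "d \<in> upper_ideal_edges R" by blast
    from d(1) obtain x y where "d = {x, y}" "x \<in> nonunits R - A" "y \<in> nonunits R - A"
      by (rule nsets2_E)
    with indep d(2) show False by blast
  qed
  then show ?thesis
    unfolding split_graph_def using AU clique
    by (intro exI[of _ A] exI[of _ "nonunits R - A"]) auto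
qed

section \<open>Isomorphisms onto the two kinds of product\<close>

text \<open>For a nonzero idempotent \<open>e\<close> with binary corner this is the projection to
  eR, with its two elements renamed to those of \<open>residue_ring 2\<close>.\<close>

definition indicator_hom :: "'a \<Rightarrow> 'a \<Rightarrow> int" where
  "indicator_hom e x = (if x \<otimes> e = \<zero> then 0 else 1)"

lemma indicator_hom:
  assumes e: "e \<in> carrier R" "e \<otimes> e = e" "e \<noteq> \<zero>" "binary_corner e"
  shows "indicator_hom e \<in> ring_hom R (residue_ring 2)"
proof (rule ring_hom_memI)
  show "indicator_hom e x \<in> carrier (residue_ring 2)" for x
    by (simp add: indicator_hom_def residue_ring_def)
  show "indicator_hom e \<one> = \<one>\<^bsub>residue_ring 2\<^esub>"
    using e by (simp add: indicator_hom_def residue_ring_def)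
  \<comment> \<open>This accounts for 1 + 1 = 0 in Z_2: the alternative
    \<open>e \<oplus> e = e\<close> would give \<open>e = \<zero>\<close>.\<close>
  have twice: "e \<oplus> e = \<zero>"
  proof -
    have "(e \<oplus> e) \<otimes> e = e \<oplus> e" using e by (simp add: l_distr)
    then have "e \<oplus> e = \<zero> \<or> e \<oplus> e = e"
      using e unfolding binary_corner_def by (metis a_closed)
    then show ?thesis using e by auto
  qed
  fix x y assume x: "x \<in> carrier R" and y: "y \<in> carrier R"
  have xy: "x \<otimes> e = \<zero> \<or> x \<otimes> e = e" "y \<otimes> e = \<zero> \<or> y \<otimes> e = e"
    using x y e by (auto simp: binary_corner_def)
  have 1: "x \<otimes> y \<otimes> e = x \<otimes> e \<otimes> (y \<otimes> e)"
  proof -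
    have "x \<otimes> e \<otimes> (y \<otimes> e) = x \<otimes> y \<otimes> (e \<otimes> e)" using x y e(1) by algebra
    then show ?thesis using e by simp
  qed
  show "indicator_hom e (x \<otimes> y) = indicator_hom e x \<otimes>\<^bsub>residue_ring 2\<^esub> indicator_hom e y"
    unfolding indicator_hom_def 1 using xy e by (auto simp: residue_ring_def)
  have 2: "(x \<oplus> y) \<otimes> e = x \<otimes> e \<oplus> y \<otimes> e" using x y e by (simp add: l_distr)
  show "indicator_hom e (x \<oplus> y) = indicator_hom e x \<oplus>\<^bsub>residue_ring 2\<^esub> indicator_hom e y"
    unfolding indicator_hom_def 2 using xy e twice by (auto simp: residue_ring_def)
qed

end

lemma ring_hom_RDirProd:
  assumes "f \<in> ring_hom R A" "g \<in> ring_hom R B"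
  shows "(\<lambda>x. (f x, g x)) \<in> ring_hom R (RDirProd A B)"
  using assms by (auto simp: ring_hom_def RDirProd_def DirProd_def monoid.defs)

context cring
begin

text \<open>The three projections together are injective because the vanishing components determine
  an element; a preimage is the sum of the idempotents whose coordinate is 1.\<close>

lemma binary_triple_iso:
  assumes t: "binary_triple e g h"
  shows "R \<simeq> RDirProd (residue_ring 2) (RDirProd (residue_ring 2) (residue_ring 2))"
proof -
  have c: "e \<in> carrier R" "g \<in> carrier R" "h \<in> carrier R" "e \<noteq> \<zero>" "g \<noteq> \<zero>" "h \<noteq> \<zero>"
    and orth: "e \<otimes> g = \<zero>" "e \<otimes> h = \<zero>" "g \<otimes> h = \<zero>"
    and b: "binary_corner e" "binary_corner g" "binary_corner h"
    using t by (auto simp: binary_triple_def)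
  have id: "e \<otimes> e = e" "g \<otimes> g = g" "h \<otimes> h = h"
    using t binary_triple_perm binary_triple_idem by blast+
  have orth': "g \<otimes> e = \<zero>" "h \<otimes> e = \<zero>" "h \<otimes> g = \<zero>"
    using orth m_comm[OF c(1,2)] m_comm[OF c(1,3)] m_comm[OF c(2,3)] by auto
  let ?\<phi> = "\<lambda>x. (indicator_hom e x, indicator_hom g x, indicator_hom h x)"
  let ?S = "RDirProd (residue_ring 2) (RDirProd (residue_ring 2) (residue_ring 2))"
  have "?\<phi> \<in> ring_hom R ?S"
    using indicator_hom c id b by (intro ring_hom_RDirProd) auto
  moreover have "bij_betw ?\<phi> (carrier R) (carrier ?S)"
  proof (rule bij_betwI')
    fix x y assume "x \<in> carrier R" "y \<in> carrier R"
    then show "?\<phi> x = ?\<phi> y \<longleftrightarrow> x = y"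
      using binary_triple_eqI[OF t, of x y] by (auto simp: indicator_hom_def split: if_splits)
  next
    fix x assume "x \<in> carrier R"
    then show "?\<phi> x \<in> carrier ?S"
      by (auto simp: RDirProd_carrier indicator_hom_def residue_ring_def)
  next
    fix s assume s: "s \<in> carrier ?S"
    obtain i j k where ijk: "s = (i, j, k)" by (cases s)
    have r: "i = 0 \<or> i = 1" "j = 0 \<or> j = 1" "k = 0 \<or> k = 1"
      using s unfolding ijk by (auto simp: RDirProd_carrier residue_ring_def)
    define x where "x = (if i = 0 then \<zero> else e) \<oplus> (if j = 0 then \<zero> else g) \<oplus> (if k = 0 then \<zero> else h)"
    have "x \<in> carrier R" using c by (simp add: x_def)
    moreover have "x \<otimes> e = (if i = 0 then \<zero> else e)" "x \<otimes> g = (if j = 0 then \<zero> else g)"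
        "x \<otimes> h = (if k = 0 then \<zero> else h)"
      using c orth orth' id by (simp_all add: x_def l_distr)
    then have "s = ?\<phi> x" using r c by (auto simp: ijk indicator_hom_def)
    ultimately show "\<exists>x\<in>carrier R. s = ?\<phi> x" by blast
  qed
  ultimately show ?thesis unfolding is_ring_iso_def ring_iso_def by blast
qed

text \<open>The ideal eR is the kernel of the projection to fR: an element without second component
  equals its first component, a multiple of \<open>e\<close>.\<close>

lemma mem_cgenideal_iff:
  assumes ef: "complementary e f" and x: "x \<in> carrier R"
  shows "x \<in> PIdl e \<longleftrightarrow> x \<otimes> f = \<zero>"
proof
  have c: "e \<in> carrier R" "f \<in> carrier R" "e \<otimes> f = \<zero>"
    using ef by (auto simp: complementary_def)
  show "x \<in> PIdl e" if "x \<otimes> f = \<zero>"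
    using complementary_split[OF ef x] that x c unfolding cgenideal_def by auto
  show "x \<otimes> f = \<zero>" if "x \<in> PIdl e"
    using that c by (auto simp: cgenideal_def m_assoc)
qed

text \<open>An ideal containing \<open>e\<close> and an element with nonzero second component also
  contains \<open>f\<close>, as that component is invertible in fR, and hence
  \<open>e \<oplus> f = \<one>\<close>. This is what makes the quotient by eR a field.\<close>

lemma field_corner_maximalideal:
  assumes ef: "complementary e f" and f: "field_corner f"
  shows "maximalideal (PIdl e) R"
proof -
  have c: "e \<in> carrier R" "f \<in> carrier R" "e \<oplus> f = \<one>" "e \<otimes> f = \<zero>" "f \<noteq> \<zero>"
    using ef by (auto simp: complementary_def)
  note id = complementary_idem[OF ef]
  show ?thesis
  proof (rule maximalidealI[OF cgenideal_ideal[OF c(1)]])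
    have "e \<notin> Units R" using nonunitsI[OF c(1,2)] c by (simp add: nonunits_def)
    then have "\<one> \<notin> PIdl e"
      using c(1) by (auto simp: cgenideal_def Units_def m_comm)
    then show "carrier R \<noteq> PIdl e" by blast
    fix J assume J: "ideal J R" "PIdl e \<subseteq> J" "J \<subseteq> carrier R"
    interpret J: ideal J R by fact
    show "J = PIdl e \<or> J = carrier R"
    proof (rule disjCI)
      assume "J \<noteq> carrier R"
      have "x \<otimes> f = \<zero>" if x: "x \<in> J" for x
      proof (rule ccontr)
        assume "x \<otimes> f \<noteq> \<zero>"
        have xc: "x \<in> carrier R" using x J by blast
        have "x \<otimes> f \<otimes> f = x \<otimes> f" using xc c id by (simp add: m_assoc)
        then obtain y where y: "y \<in> carrier R" "x \<otimes> f \<otimes> y = f"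
          using \<open>x \<otimes> f \<noteq> \<zero>\<close> f xc c unfolding field_corner_def by (metis m_closed)
        have "f \<in> J" using J.I_r_closed[OF J.I_r_closed[OF x c(2)] y(1)] y by simp
        moreover have "e \<in> J" using J(2) cgenideal_self[OF c(1)] by blast
        ultimately have "\<one> \<in> J" using J.a_closed[of e f] c by simp
        then show False using J.one_imp_carrier \<open>J \<noteq> carrier R\<close> by blast
      qed
      then show "J = PIdl e" using mem_cgenideal_iff[OF ef] J by blast
    qed
  qed
qed

text \<open>The field \<open>fR\<close> is realised on an initial segment of \<open>\<nat>\<close> as the image of \<open>x \<mapsto> x f\<close>.\<close>

lemma binary_field_iso:
  assumes fin: "finite (carrier R)" and ef: "complementary e f"
    and e: "binary_corner e" and f: "field_corner f"
  shows "\<exists>F :: nat ring. field F \<and> finite (carrier F) \<and> R \<simeq> RDirProd (residue_ring 2) F"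
proof -
  have c: "e \<in> carrier R" "f \<in> carrier R" "e \<oplus> f = \<one>" "e \<otimes> f = \<zero>" "e \<noteq> \<zero>" "f \<noteq> \<zero>"
    using ef by (auto simp: complementary_def)
  note id = complementary_idem[OF ef]
  obtain \<psi> :: "'a \<Rightarrow> nat" where \<psi>: "inj_on \<psi> (carrier R)"
    using finite_imp_inj_to_nat_seg[OF fin] by blast
  define \<pi> where "\<pi> x = \<psi> (x \<otimes> f)" for x
  have eq: "\<pi> a = \<pi> b \<longleftrightarrow> a \<otimes> f = b \<otimes> f" if "a \<in> carrier R" "b \<in> carrier R" for a b
    using inj_on_eq_iff[OF \<psi>] that c by (simp add: \<pi>_def)
  \<comment> \<open>The fibres of \<open>\<pi>\<close> are the cosets of eR, so its image carries
    the structure of the quotient ring.\<close>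
  have w: "weak_ring_morphism \<pi> (PIdl e) R"
  proof (rule weak_ring_morphismI[OF cgenideal_ideal[OF c(1)]])
    fix a b assume ab: "a \<in> carrier R" "b \<in> carrier R"
    have "(a \<ominus> b) \<otimes> f = a \<otimes> f \<ominus> b \<otimes> f" using ab c(2) by algebra
    then show "\<pi> a = \<pi> b \<longleftrightarrow> a \<ominus> b \<in> PIdl e"
      using eq[OF ab] mem_cgenideal_iff[OF ef, of "a \<ominus> b"] ab c by (simp add: r_right_minus_eq)
  qed
  define F where "F = image_ring \<pi> R"
  have hom: "\<pi> \<in> ring_hom R F" unfolding F_def using weak_ring_morphism_is_hom[OF w] .
  have field: "field F"
    unfolding F_def
    using image_ring_is_field[OF w] field_corner_maximalideal[OF ef f]
      maximalideal.quotient_is_field[OF _ is_cring] by blast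
  have carF: "carrier F = \<pi> ` carrier R" by (simp add: F_def image_ring_carrier)
  let ?\<phi> = "\<lambda>x. (indicator_hom e x, \<pi> x)"
  have "?\<phi> \<in> ring_hom R (RDirProd (residue_ring 2) F)"
    using indicator_hom c id e hom by (intro ring_hom_RDirProd) auto
  moreover have "bij_betw ?\<phi> (carrier R) (carrier (RDirProd (residue_ring 2) F))"
  proof (rule bij_betwI')
    fix x y assume xy: "x \<in> carrier R" "y \<in> carrier R"
    have "x = y" if "?\<phi> x = ?\<phi> y"
    proof -
      have "x \<otimes> f = y \<otimes> f" using that eq[OF xy] by simp
      moreover have "x \<otimes> e = y \<otimes> e"
        using that binary_corner_eqI[OF e xy] by (auto simp: indicator_hom_def split: if_splits)
      ultimately show ?thesis
        using complementary_split[OF ef xy(1)] complementary_split[OF ef xy(2)] by simp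
    qed
    then show "?\<phi> x = ?\<phi> y \<longleftrightarrow> x = y" by auto
  next
    fix x assume "x \<in> carrier R"
    then show "?\<phi> x \<in> carrier (RDirProd (residue_ring 2) F)"
      by (auto simp: RDirProd_carrier indicator_hom_def residue_ring_def carF)
  next
    fix s assume s: "s \<in> carrier (RDirProd (residue_ring 2) F)"
    obtain i j where "s = (i, j)" by (cases s)
    with s have "0 \<le> i" "i \<le> 1" "j \<in> \<pi> ` carrier R" "s = (i, j)"
      by (auto simp: RDirProd_carrier residue_ring_def carF)
    then obtain y where y: "s = (i, \<pi> y)" "i = 0 \<or> i = 1" "y \<in> carrier R" by force
    define x where "x = y \<otimes> f \<oplus> (if i = 0 then \<zero> else e)"
    have x: "x \<in> carrier R" using y c by (simp add: x_def)
    have "x \<otimes> e = (if i = 0 then \<zero> else e)" "x \<otimes> f = y \<otimes> f"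
      using y c id by (auto simp: x_def l_distr m_assoc)
    then have "s = ?\<phi> x" using y c eq[OF x y(3)] by (auto simp: indicator_hom_def)
    then show "\<exists>x\<in>carrier R. s = ?\<phi> x" using x by blast
  qed
  ultimately have "R \<simeq> RDirProd (residue_ring 2) F" unfolding is_ring_iso_def ring_iso_def by blast
  moreover have "finite (carrier F)" using carF fin by simp
  ultimately show ?thesis using field by blast
qed

section \<open>Idempotents pulled back from the products\<close>

text \<open>\<open>e\<close> and \<open>f\<close> are the preimages of (1, 0) and (0, 1). By
  injectivity of \<open>\<phi>\<close>, identities in \<open>R\<close> are verified by computing in
  the product.\<close>

lemma iso_binary_field:
  assumes iso: "R \<simeq> RDirProd (residue_ring 2) F" and "field F"
  shows "\<exists>e f. complementary e f \<and> binary_corner e \<and> field_corner f"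
proof -
  interpret F: field F by fact
  interpret Z: cring "residue_ring 2" by (rule residues.cring) (simp add: residues_def)
  let ?S = "RDirProd (residue_ring 2) F"
  have Z: "carrier (residue_ring 2) = {0, 1}" by (auto simp: residue_ring_def)
  have S: "carrier ?S = {0, 1} \<times> carrier F" by (simp add: RDirProd_carrier Z)
  have ops: "\<zero>\<^bsub>?S\<^esub> = (0, \<zero>\<^bsub>F\<^esub>)" "\<one>\<^bsub>?S\<^esub> = (1, \<one>\<^bsub>F\<^esub>)"
    "\<And>a b c d. (a, b) \<otimes>\<^bsub>?S\<^esub> (c, d) = (a * c mod 2, b \<otimes>\<^bsub>F\<^esub> d)"
    "\<And>a b c d. (a, b) \<oplus>\<^bsub>?S\<^esub> (c, d) = ((a + c) mod 2, b \<oplus>\<^bsub>F\<^esub> d)"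
    by (auto simp: RDirProd_def DirProd_def monoid.defs residue_ring_def)
  obtain \<phi> where \<phi>: "\<phi> \<in> ring_iso R ?S" using iso by (auto simp: is_ring_iso_def)
  then have hom: "\<phi> \<in> ring_hom R ?S" and bij: "bij_betw \<phi> (carrier R) (carrier ?S)"
    by (auto simp: ring_iso_def)
  note h = ring_hom_closed[OF hom] ring_hom_mult[OF hom] ring_hom_add[OF hom] ring_hom_one[OF hom]
    ring_hom_zero[OF hom ring_axioms RDirProd_ring[OF Z.ring_axioms F.ring_axioms]]
  have inj: "\<phi> x = \<phi> y \<longleftrightarrow> x = y" if "x \<in> carrier R" "y \<in> carrier R" for x y
    using inj_on_eq_iff[OF bij_betw_imp_inj_on[OF bij]] that by blast
  have surj: "\<exists>x\<in>carrier R. \<phi> x = s" if "s \<in> carrier ?S" for s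
    using bij_betw_imp_surj_on[OF bij] that by (metis imageE)
  have val: "\<exists>a b. \<phi> x = (a, b) \<and> (a = 0 \<or> a = 1) \<and> b \<in> carrier F" if "x \<in> carrier R" for x
    using h(1)[OF that] unfolding S by auto
  obtain e where e: "e \<in> carrier R" "\<phi> e = (1, \<zero>\<^bsub>F\<^esub>)"
    using surj[of "(1, \<zero>\<^bsub>F\<^esub>)"] by (auto simp: S)
  obtain f where f: "f \<in> carrier R" "\<phi> f = (0, \<one>\<^bsub>F\<^esub>)"
    using surj[of "(0, \<one>\<^bsub>F\<^esub>)"] by (auto simp: S)
  have "complementary e f"
    unfolding complementary_def
    using inj[of "e \<oplus> f" \<one>] inj[of "e \<otimes> f" \<zero>] inj[of e \<zero>] inj[of f \<zero>] e f
    by (auto simp: h ops)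
  moreover have "binary_corner e"
    unfolding binary_corner_def
  proof
    fix x assume x: "x \<in> carrier R"
    obtain a b where "\<phi> x = (a, b)" "a = 0 \<or> a = 1" "b \<in> carrier F" using val[OF x] by blast
    then show "x \<otimes> e = \<zero> \<or> x \<otimes> e = e"
      using inj[of "x \<otimes> e" \<zero>] inj[of "x \<otimes> e" e] x e by (auto simp: h ops)
  qed
  moreover have "field_corner f"
    unfolding field_corner_def
  proof (intro ballI impI)
    fix x assume x: "x \<in> carrier R" "x \<otimes> f = x" "x \<noteq> \<zero>"
    obtain a b where ab: "\<phi> x = (a, b)" "b \<in> carrier F" using val[OF x(1)] by blast
    \<comment> \<open>As \<open>x = x \<otimes> f\<close>, the first component of
      \<open>\<phi> x\<close> is zero, and inverting the second one suffices.\<close>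
    have "\<phi> (x \<otimes> f) = (0, b)" unfolding h(2)[OF x(1) f(1)] using f ab by (simp add: ops)
    then have a: "a = 0" using x ab by simp
    have "b \<noteq> \<zero>\<^bsub>F\<^esub>" using inj[OF x(1) zero_closed] x ab a by (auto simp: h ops)
    then have b: "inv\<^bsub>F\<^esub> b \<in> carrier F" "b \<otimes>\<^bsub>F\<^esub> inv\<^bsub>F\<^esub> b = \<one>\<^bsub>F\<^esub>"
      using ab(2) F.field_Units by auto
    obtain y where y: "y \<in> carrier R" "\<phi> y = (0, inv\<^bsub>F\<^esub> b)"
      using surj[of "(0, inv\<^bsub>F\<^esub> b)"] b by (auto simp: S)
    have "x \<otimes> y = f"
      using inj[of "x \<otimes> y" f] x y f ab a b by (auto simp: h ops)
    then show "\<exists>y\<in>carrier R. x \<otimes> y = f" using y by blast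
  qed
  ultimately show ?thesis by blast
qed

text \<open>The triple consists of the preimages of the three unit vectors.\<close>

lemma iso_binary_triple:
  assumes iso: "R \<simeq> RDirProd (residue_ring 2) (RDirProd (residue_ring 2) (residue_ring 2))"
  shows "\<exists>e g h. binary_triple e g h"
proof -
  interpret Z: cring "residue_ring 2" by (rule residues.cring) (simp add: residues_def)
  let ?S = "RDirProd (residue_ring 2) (RDirProd (residue_ring 2) (residue_ring 2))"
  have Z: "carrier (residue_ring 2) = {0, 1}" by (auto simp: residue_ring_def)
  have S: "carrier ?S = {0, 1} \<times> {0, 1} \<times> {0, 1}" by (simp add: RDirProd_carrier Z)
  have ops: "\<zero>\<^bsub>?S\<^esub> = (0, 0, 0)" "\<one>\<^bsub>?S\<^esub> = (1, 1, 1)"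
    "\<And>a b c a' b' c'. (a, b, c) \<otimes>\<^bsub>?S\<^esub> (a', b', c') = (a * a' mod 2, b * b' mod 2, c * c' mod 2)"
    "\<And>a b c a' b' c'. (a, b, c) \<oplus>\<^bsub>?S\<^esub> (a', b', c') =
      ((a + a') mod 2, (b + b') mod 2, (c + c') mod 2)"
    by (auto simp: RDirProd_def DirProd_def monoid.defs residue_ring_def)
  obtain \<phi> where \<phi>: "\<phi> \<in> ring_iso R ?S" using iso by (auto simp: is_ring_iso_def)
  then have hom: "\<phi> \<in> ring_hom R ?S" and bij: "bij_betw \<phi> (carrier R) (carrier ?S)"
    by (auto simp: ring_iso_def)
  note h = ring_hom_closed[OF hom] ring_hom_mult[OF hom] ring_hom_add[OF hom] ring_hom_one[OF hom]
    ring_hom_zero[OF hom ring_axioms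
      RDirProd_ring[OF Z.ring_axioms RDirProd_ring[OF Z.ring_axioms Z.ring_axioms]]]
  have inj: "\<phi> x = \<phi> y \<longleftrightarrow> x = y" if "x \<in> carrier R" "y \<in> carrier R" for x y
    using inj_on_eq_iff[OF bij_betw_imp_inj_on[OF bij]] that by blast
  have surj: "\<exists>x\<in>carrier R. \<phi> x = s" if "s \<in> carrier ?S" for s
    using bij_betw_imp_surj_on[OF bij] that by (metis imageE)
  obtain e where e: "e \<in> carrier R" "\<phi> e = (1, 0, 0)" using surj[of "(1, 0, 0)"] by (auto simp: S)
  obtain g where g: "g \<in> carrier R" "\<phi> g = (0, 1, 0)" using surj[of "(0, 1, 0)"] by (auto simp: S)
  obtain k where k: "k \<in> carrier R" "\<phi> k = (0, 0, 1)" using surj[of "(0, 0, 1)"] by (auto simp: S)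
  have binary: "binary_corner c"
    if c: "c \<in> carrier R" "\<phi> c \<in> {(1, 0, 0), (0, 1, 0), (0, 0, 1)}" for c
    unfolding binary_corner_def
  proof
    fix x assume x: "x \<in> carrier R"
    show "x \<otimes> c = \<zero> \<or> x \<otimes> c = c"
      using h(1)[OF x] inj[of "x \<otimes> c" \<zero>] inj[of "x \<otimes> c" c] x c unfolding S by (auto simp: h ops)
  qed
  have "e \<oplus> g \<oplus> k = \<one>" using inj[of "e \<oplus> g \<oplus> k" \<one>] e g k by (simp add: h ops)
  moreover have "e \<otimes> g = \<zero>" "e \<otimes> k = \<zero>" "g \<otimes> k = \<zero>"
    using inj[of "e \<otimes> g" \<zero>] inj[of "e \<otimes> k" \<zero>] inj[of "g \<otimes> k" \<zero>] e g k by (auto simp: h ops)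
  moreover have "e \<noteq> \<zero>" "g \<noteq> \<zero>" "k \<noteq> \<zero>" using e g k h(5) ops(1) by auto
  ultimately have "binary_triple e g k"
    unfolding binary_triple_def using binary e g k by auto
  then show ?thesis by blast
qed

end

text \<open>Every finite field has an isomorphic copy with carrier in \<open>nat\<close>, so
  \<open>F\<close> over that type stands for an arbitrary finite field.\<close>

theorem theorem3p1:
  fixes R :: "('a, 'm) ring_scheme"
  assumes "cring R"
    and "finite (carrier R)"
    and "\<one>\<^bsub>R\<^esub> \<noteq> \<zero>\<^bsub>R\<^esub>"
    and "\<not> local_ring R"
  shows "split_graph (nonunits R) (upper_ideal_edges R) \<longleftrightarrow>
    R \<simeq> RDirProd (residue_ring 2) (RDirProd (residue_ring 2) (residue_ring 2)) \<or>
    (\<exists>F :: nat ring. field F \<and> finite (carrier F) \<and> R \<simeq> RDirProd (residue_ring 2) F)"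
proof -
  interpret cring R by fact
  show ?thesis
  proof
    assume "split_graph (nonunits R) (upper_ideal_edges R)"
    from split_imp_decomposition[OF assms(2-4) this] show
      "R \<simeq> RDirProd (residue_ring 2) (RDirProd (residue_ring 2) (residue_ring 2)) \<or>
        (\<exists>F :: nat ring. field F \<and> finite (carrier F) \<and> R \<simeq> RDirProd (residue_ring 2) F)"
      using binary_triple_iso binary_field_iso[OF assms(2)] by blast
  next
    assume "R \<simeq> RDirProd (residue_ring 2) (RDirProd (residue_ring 2) (residue_ring 2)) \<or>
      (\<exists>F :: nat ring. field F \<and> finite (carrier F) \<and> R \<simeq> RDirProd (residue_ring 2) F)"
    then show "split_graph (nonunits R) (upper_ideal_edges R)"
      using iso_binary_triple iso_binary_field split_graph_of_binary_triple
        split_graph_of_binary_field by blast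
  qed
qed

end
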